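(* Let $\epsilon_1,\epsilon_2\geq 0$ and let the parameters $a,p\in[\tfrac12,1)$, $b\in(0,\tfrac12]$ of the mechanism PCKV-UE satisfy $$\frac{a(1-b)}{b(1-a)}=e^{\epsilon_1},\qquad p=\frac{e^{\epsilon_2}}{e^{\epsilon_2}+1}.$$ Then PCKV-UE satisfies $\epsilon$-LDP with $$\epsilon=\max\left\{\epsilon_2,\ \epsilon_1+\ln\frac{2}{1+e^{-\epsilon_2}}\right\},$$ and moreover $\epsilon\leq\epsilon_1+\epsilon_2$.
   Context: **Data.** Let $d,\ell\geq1$ be integers ($\ell$ is the padding length), $\mathcal K=\{1,\dots,d\}$, $d'=d+\ell$, $\mathcal K'=\{1,\dots,d'\}$. An input is a nonempty finite set $\mathcal S$ of key-value pairs $\langle i,v_i^*\rangle$ with distinct keys $i\in\mathcal K$ and values $v_i^*\in[-1,1]$. The keys $d+1,\dots,d'$ are dummy keys. **Local differential privacy.** A randomized mechanism $\mathcal M$ satisfies $\epsilon$-LDP if for every pair of inputs $x,x'$ and every output $y$, $\Pr(\mathcal M(x)=y)\leq e^{\epsilon}\Pr(\mathcal M(x')=y)$. Here inputs range over all key-value sets $\mathcal S$. **Padding-and-Sampling.** Given $\mathcal S$, let $\eta=\frac{|\mathcal S|}{\max\{|\mathcal S|,\ell\}}$ and draw $B\sim\mathrm{Bernoulli}(\eta)$. If $B=1$, draw $\langle k,v^*\rangle$ uniformly from $\mathcal S$; if $B=0$, set $v^*=0$ and draw $k$ uniformly from $\{d+1,\dots,d'\}$. Then set $v=1$ with probability $\frac{1+v^*}{2}$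 and $v=-1$ with probability $\frac{1-v^*}{2}$. Return $\langle k,v\rangle$. **PCKV-UE** (parameters $a,p\in[\frac12,1)$, $b\in(0,\frac12]$). Given $\mathcal S$, obtain $\langle k,v\rangle$ by Padding-and-Sampling. Output a random vector $\mathbf y\in\{1,-1,0\}^{d'}$ with (given $\langle k,v\rangle$) independent coordinates: $\mathbf y[k]$ equals $v$ with probability $ap$, $-v$ with probability $a(1-p)$, and $0$ with probability $1-a$; for each $i\in\mathcal K'\setminus\{k\}$, $\mathbf y[i]$ equals $1$ with probability $b/2$, $-1$ with probability $b/2$, and $0$ with probability $1-b$. *)

theory Defs
  imports "HOL-Probability.Probability" "HOL-Library.Monad_Syntax"
begin

text \<open>A key is a natural number; an input is a nonempty finite set of key-value pairs with
  pairwise distinct keys from \<open>{1..d}\<close> and values in \<open>[-1,1]\<close>.\<close>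

definition kv_inputs :: "nat \<Rightarrow> (nat \<times> real) set set" where
  "kv_inputs d = {S. finite S \<and> S \<noteq> {} \<and> inj_on fst S \<and> S \<subseteq> {1..d} \<times> {-1..1}}"

definition satisfies_LDP :: "'x set \<Rightarrow> ('x \<Rightarrow> 'y pmf) \<Rightarrow> real \<Rightarrow> bool" where
  "satisfies_LDP X M \<epsilon> \<longleftrightarrow>
     (\<forall>x\<in>X. \<forall>x'\<in>X. \<forall>y. pmf (M x) y \<le> exp \<epsilon> * pmf (M x') y)"

definition sampling_rate :: "nat \<Rightarrow> (nat \<times> real) set \<Rightarrow> real" where
  "sampling_rate l S = real (card S) / real (max (card S) l)"

text \<open>\<open>pmf_of_list\<close> lists outcomes with their probabilities; it is meaningful only for
  lists satisfying \<open>pmf_of_list_wf\<close>, which is proved below for the lists used here.\<close>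

definition discretize :: "real \<Rightarrow> int pmf" where
  "discretize w = pmf_of_list [(1, (1 + w) / 2), (-1, (1 - w) / 2)]"

definition padding_and_sampling :: "nat \<Rightarrow> nat \<Rightarrow> (nat \<times> real) set \<Rightarrow> (nat \<times> int) pmf" where
  "padding_and_sampling d l S = do {
     B \<leftarrow> bernoulli_pmf (sampling_rate l S);
     (k, w) \<leftarrow> (if B then pmf_of_set S
                else map_pmf (\<lambda>k. (k, 0)) (pmf_of_set {d + 1..d + l}));
     v \<leftarrow> discretize w;
     return_pmf (k, v)
   }"

definition perturb_sampled :: "real \<Rightarrow> real \<Rightarrow> int \<Rightarrow> int pmf" where
  "perturb_sampled a p v = pmf_of_list [(v, a * p), (- v, a * (1 - p)), (0, 1 - a)]"

definition perturb_other :: "real \<Rightarrow> int pmf" where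
  "perturb_other b = pmf_of_list [(1, b / 2), (-1, b / 2), (0, 1 - b)]"

text \<open>The output vector is a function on the keys \<open>{1..d + l}\<close>, extended by \<open>0\<close> to all of
  \<open>nat\<close>; \<open>Pi_pmf\<close> makes its coordinates independent.\<close>

definition PCKV_UE ::
  "nat \<Rightarrow> nat \<Rightarrow> real \<Rightarrow> real \<Rightarrow> real \<Rightarrow> (nat \<times> real) set \<Rightarrow> (nat \<Rightarrow> int) pmf" where
  "PCKV_UE d l a b p S = do {
     (k, v) \<leftarrow> padding_and_sampling d l S;
     Pi_pmf {1..d + l} 0 (\<lambda>i. if i = k then perturb_sampled a p v else perturb_other b)
   }"

lemma discretize_wf:
  fixes w :: real
  shows
  "w \<in> {-1..1} \<Longrightarrow> pmf_of_list_wf [(1::int, (1 + w) / 2), (-1, (1 - w) / 2)]"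
  by (rule pmf_of_list_wfI) (auto simp: field_simps)

lemma perturb_sampled_wf:
  fixes a p :: real
  shows
  "a \<in> {0..1} \<Longrightarrow> p \<in> {0..1} \<Longrightarrow>
     pmf_of_list_wf [(v::int, a * p), (- v, a * (1 - p)), (0, 1 - a)]"
  by (rule pmf_of_list_wfI, auto, simp add: algebra_simps)

lemma perturb_other_wf:
  fixes b :: real
  shows
  "b \<in> {0..1} \<Longrightarrow> pmf_of_list_wf [(1::int, b / 2), (-1, b / 2), (0, 1 - b)]"
  by (rule pmf_of_list_wfI) auto

end

theory Submission
  imports Defs
begin

text \<open>Compare every output distribution with one reference distribution, the product of
  \<open>perturb_other b\<close> over all keys, which does not depend on the input. Given the sampled pair
  \<open>\<langle>k, v\<rangle>\<close>, the likelihood ratio to the reference at \<open>y\<close> only involves coordinate \<open>k\<close>,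
  where it is \<open>(1 - a) / (1 - b)\<close>, \<open>2ap / b\<close> or \<open>2a(1 - p) / b\<close>. Mixing over
  \<open>\<langle>k, v\<rangle>\<close> keeps the ratio between the smallest and the largest of these numbers, and the
  quotient of the two extremes is \<open>exp \<epsilon>\<close>.\<close>

text \<open>The mass of a mixture at \<open>y\<close> is the average of the masses of its
  components, so bounds that hold on the support of \<open>M\<close> survive averaging.\<close>

lemma pmf_bind_bounds:
  assumes "\<And>x. x \<in> set_pmf M \<Longrightarrow> lo \<le> pmf (f x) y \<and> pmf (f x) y \<le> hi"
  shows "lo \<le> pmf (bind_pmf M f) y \<and> pmf (bind_pmf M f) y \<le> hi"
proof
  have int: "integrable (measure_pmf M) (\<lambda>x. pmf (f x) y)"
    by (rule measure_pmf.integrable_const_bound[where B = 1]) (auto simp: pmf_le_1)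
  show "lo \<le> pmf (bind_pmf M f) y"
    unfolding pmf_bind
    by (rule measure_pmf.integral_ge_const[OF int]) (use assms in \<open>auto simp: AE_measure_pmf_iff\<close>)
  show "pmf (bind_pmf M f) y \<le> hi"
    unfolding pmf_bind
    by (rule measure_pmf.integral_le_const[OF int]) (use assms in \<open>auto simp: AE_measure_pmf_iff\<close>)
qed

text \<open>The two products share every factor except the one at \<open>k\<close>, so a bound at
  that coordinate is multiplied by the common nonnegative factor \<open>R\<close>.\<close>

lemma Pi_pmf_replace_bounds:
  assumes A: "finite A" "k \<in> A"
    and coord: "\<And>z. lo * pmf h z \<le> pmf g z \<and> pmf g z \<le> hi * pmf h z"
  shows "lo * pmf (Pi_pmf A dflt (\<lambda>i. h)) y \<le> pmf (Pi_pmf A dflt (\<lambda>i. if i = k then g else h)) y \<and>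
    pmf (Pi_pmf A dflt (\<lambda>i. if i = k then g else h)) y \<le> hi * pmf (Pi_pmf A dflt (\<lambda>i. h)) y"
proof (cases "\<forall>x. x \<notin> A \<longrightarrow> y x = dflt")
  case True
  define R where "R = (\<Prod>i\<in>A - {k}. pmf h (y i))"
  have "R \<ge> 0"
    unfolding R_def by (intro prod_nonneg) auto
  moreover have "pmf (Pi_pmf A dflt (\<lambda>i. h)) y = pmf h (y k) * R"
    using A True unfolding R_def by (simp add: pmf_Pi prod.remove)
  moreover have "pmf (Pi_pmf A dflt (\<lambda>i. if i = k then g else h)) y = pmf g (y k) * R"
    using A True unfolding R_def by (simp add: pmf_Pi prod.remove)
  ultimately show ?thesis
    using coord[of "y k"] by (auto simp flip: mult.assoc intro!: mult_right_mono)
next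
  case False
  \<comment> \<open>Here \<open>y\<close> differs from the default somewhere outside
    \<open>A\<close>, so both products give it mass 0.\<close>
  then show ?thesis
    by (simp only: pmf_Pi[OF A(1)] if_False mult_zero_right order_refl simp_thms)
qed

text \<open>The ratios at \<open>0\<close>, \<open>v\<close> and \<open>- v\<close> are
  \<open>(1 - a) / (1 - b)\<close>, \<open>2 * a * p / b\<close> and
  \<open>2 * a * (1 - p) / b\<close>. The second is always the largest; which of the others is
  smallest depends on the parameters, hence the \<open>min\<close>.\<close>

lemma perturb_sampled_bounds:
  fixes a b p :: real and v :: int
  defines "lo \<equiv> min ((1 - a) / (1 - b)) (2 * a * (1 - p) / b)"
    and "hi \<equiv> 2 * a * p / b"
  assumes a: "a \<in> {1/2..<1}" and p: "p \<in> {1/2..<1}" and b: "b \<in> {0<..1/2}"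
    and v: "v \<in> {1, -1}"
  shows "lo * pmf (perturb_other b) z \<le> pmf (perturb_sampled a p v) z \<and>
    pmf (perturb_sampled a p v) z \<le> hi * pmf (perturb_other b) z"
proof -
  have other: "pmf (perturb_other b) z =
      (if z = 0 then 1 - b else if z = 1 \<or> z = -1 then b / 2 else 0)"
    unfolding perturb_other_def using b
    by (subst pmf_pmf_of_list[OF perturb_other_wf]) auto
  have sampled: "pmf (perturb_sampled a p v) z =
      (if z = 0 then 1 - a else if z = v then a * p else if z = - v then a * (1 - p) else 0)"
    unfolding perturb_sampled_def using a p v
    by (subst pmf_pmf_of_list[OF perturb_sampled_wf]) auto
  \<comment> \<open>The number 1 separates the two ratios, because \<open>b\<close> is at most 1/2
    and both \<open>a\<close> and \<open>p\<close> are at least 1/2.\<close>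
  have "(1 - a) / (1 - b) \<le> 1"
    using a b by simp
  also have "1 \<le> hi"
  proof -
    have "b * 1 \<le> a * (2 * p)"
      using a p b by (intro mult_mono) auto
    then show ?thesis
      using b by (simp add: hi_def)
  qed
  finally have zero_hi: "(1 - a) / (1 - b) \<le> hi" .
  have "2 * a * (1 - p) / b \<le> hi"
    unfolding hi_def using a p b by (intro divide_right_mono mult_left_mono) auto
  then have "a * (1 - p) \<le> hi * (b / 2)" "1 - a \<le> hi * (1 - b)"
    using zero_hi b by (simp_all add: pos_divide_le_eq mult_ac)
  moreover have "a * p \<le> hi * (b / 2)"
    using b by (simp add: hi_def)
  moreover have "lo \<le> 2 * a * p / b"
    using \<open>2 * a * (1 - p) / b \<le> hi\<close> unfolding lo_def hi_def by linarith
  then have "lo * (b / 2) \<le> a * p"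
    using b by (simp add: field_simps)
  moreover have "lo \<le> 2 * a * (1 - p) / b" "lo \<le> (1 - a) / (1 - b)"
    by (simp_all add: lo_def)
  then have "lo * (b / 2) \<le> a * (1 - p)" "lo * (1 - b) \<le> 1 - a"
    using b by (simp_all add: pos_le_divide_eq mult_ac)
  ultimately show ?thesis
    unfolding other sampled using v by auto
qed

text \<open>Ensures that the coordinate bounds apply to every sampled pair. Since \<open>l\<close>
  is positive, the set of dummy keys is nonempty, so \<open>pmf_of_set\<close> is meaningful on
  it.\<close>

lemma set_padding_and_sampling:
  assumes "l \<ge> 1" and S: "S \<in> kv_inputs d"
  shows "set_pmf (padding_and_sampling d l S) \<subseteq> {1..d + l} \<times> {1, -1}"
proof -
  have discretize: "set_pmf (discretize w) \<subseteq> {1, -1}" if "w \<in> {-1..1}" for w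
    using set_pmf_of_list[OF discretize_wf[OF that]] unfolding discretize_def by simp
  define X where
    "X B = (if B then pmf_of_set S else map_pmf (\<lambda>k. (k, 0)) (pmf_of_set {d + 1..d + l}))" for B
  have X: "k \<in> {1..d + l} \<and> w \<in> {-1..1}" if "(k, w) \<in> set_pmf (X B)" for B k w
    using that assms by (auto simp: X_def kv_inputs_def split: if_splits)
  show ?thesis
  proof
    fix kv
    assume "kv \<in> set_pmf (padding_and_sampling d l S)"
    then obtain B k w v where "(k, w) \<in> set_pmf (X B)" "v \<in> set_pmf (discretize w)" "kv = (k, v)"
      unfolding padding_and_sampling_def X_def[symmetric] by auto
    then show "kv \<in> {1..d + l} \<times> {1, -1}"
      using X discretize by blast
  qed
qed

lemma exp_privacy_level:
  fixes \<epsilon>\<^sub>1 \<epsilon>\<^sub>2 :: real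
  shows "exp (max \<epsilon>\<^sub>2 (\<epsilon>\<^sub>1 + ln (2 / (1 + exp (- \<epsilon>\<^sub>2))))) =
    max (exp \<epsilon>\<^sub>2) (exp \<epsilon>\<^sub>1 * (2 * (exp \<epsilon>\<^sub>2 / (exp \<epsilon>\<^sub>2 + 1))))"
proof -
  have pos: "exp \<epsilon>\<^sub>2 + 1 > 0" "1 + exp (- \<epsilon>\<^sub>2) > 0"
    by (simp_all add: add_pos_pos)
  then have "2 / (1 + exp (- \<epsilon>\<^sub>2)) = 2 * (exp \<epsilon>\<^sub>2 / (exp \<epsilon>\<^sub>2 + 1))"
    by (simp add: exp_minus field_simps)
  moreover have "exp (ln (2 / (1 + exp (- \<epsilon>\<^sub>2)))) = 2 / (1 + exp (- \<epsilon>\<^sub>2))"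
    using pos by simp
  moreover have exp_max: "exp (max x y) = max (exp x) (exp y)" for x y :: real
    by (simp add: max_def)
  ultimately show ?thesis
    by (simp only: exp_max exp_add)
qed

theorem theorem2:
  fixes d l :: nat and a b p \<epsilon>\<^sub>1 \<epsilon>\<^sub>2 \<epsilon> :: real
  assumes "d \<ge> 1" and "l \<ge> 1"
    and "\<epsilon>\<^sub>1 \<ge> 0" and "\<epsilon>\<^sub>2 \<ge> 0"
    and "a \<in> {1/2..<1}" and "p \<in> {1/2..<1}" and "b \<in> {0<..1/2}"
    and "a * (1 - b) / (b * (1 - a)) = exp \<epsilon>\<^sub>1"
    and "p = exp \<epsilon>\<^sub>2 / (exp \<epsilon>\<^sub>2 + 1)"
    and "\<epsilon> = max \<epsilon>\<^sub>2 (\<epsilon>\<^sub>1 + ln (2 / (1 + exp (- \<epsilon>\<^sub>2))))"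
  shows "satisfies_LDP (kv_inputs d) (PCKV_UE d l a b p) \<epsilon> \<and> \<epsilon> \<le> \<epsilon>\<^sub>1 + \<epsilon>\<^sub>2"
proof
  define lo where "lo = min ((1 - a) / (1 - b)) (2 * a * (1 - p) / b)"
  define hi where "hi = 2 * a * p / b"
  define Q where "Q = Pi_pmf {1..d + l} 0 (\<lambda>i. perturb_other b)"
  \<comment> \<open>Stated with products instead of quotients, so that outputs with
    \<open>pmf Q y = 0\<close> are covered too.\<close>
  have ratio: "lo * pmf Q y \<le> pmf (PCKV_UE d l a b p S) y \<and>
      pmf (PCKV_UE d l a b p S) y \<le> hi * pmf Q y" if "S \<in> kv_inputs d" for S y
  proof -
    show ?thesis
      unfolding PCKV_UE_def
    proof (rule pmf_bind_bounds)
      fix kv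
      assume "kv \<in> set_pmf (padding_and_sampling d l S)"
      then obtain k v where kv: "kv = (k, v)" "k \<in> {1..d + l}" "v \<in> {1, -1}"
        using set_padding_and_sampling[OF \<open>l \<ge> 1\<close> \<open>S \<in> kv_inputs d\<close>] by blast
      show "lo * pmf Q y \<le> pmf (case kv of (k, v) \<Rightarrow> Pi_pmf {1..d + l} 0
            (\<lambda>i. if i = k then perturb_sampled a p v else perturb_other b)) y \<and>
          pmf (case kv of (k, v) \<Rightarrow> Pi_pmf {1..d + l} 0
            (\<lambda>i. if i = k then perturb_sampled a p v else perturb_other b)) y \<le> hi * pmf Q y"
        unfolding Q_def kv(1) prod.case lo_def hi_def
        by (intro Pi_pmf_replace_bounds perturb_sampled_bounds finite_atLeastAtMost kv assms)
    qed
  qed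

  \<comment> \<open>The two entries are \<open>hi\<close> divided by the two candidates for
    \<open>lo\<close>, in reverse order of the \<open>min\<close>.\<close>
  have exp_eps: "exp \<epsilon> = max (p / (1 - p)) (a * (1 - b) / (b * (1 - a)) * (2 * p))"
  proof -
    have "exp \<epsilon>\<^sub>2 + 1 > 0"
      by (simp add: add_pos_pos)
    then have "p = exp \<epsilon>\<^sub>2 * (1 - p)"
      using assms(9) by (simp add: field_simps)
    then have "p / (1 - p) = exp \<epsilon>\<^sub>2"
      using assms(6) by (simp add: nonzero_divide_eq_eq)
    then show ?thesis
      unfolding assms(8,10) exp_privacy_level using assms(9) by simp
  qed
  have hi_le: "hi \<le> exp \<epsilon> * lo"
  \<comment> \<open>Whichever candidate attains \<open>lo\<close>, its quotient is one of the
    entries of the maximum.\<close>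
  proof (cases "(1 - a) / (1 - b) \<le> 2 * a * (1 - p) / b")
    case True
    have "hi = a * (1 - b) / (b * (1 - a)) * (2 * p) * ((1 - a) / (1 - b))"
      using assms(5,7) by (simp add: hi_def)
    also have "\<dots> \<le> exp \<epsilon> * ((1 - a) / (1 - b))"
      unfolding exp_eps using assms(5,7) by (intro mult_right_mono) auto
    finally show ?thesis
      using True by (simp add: lo_def)
  next
    case False
    have "hi = p / (1 - p) * (2 * a * (1 - p) / b)"
      using assms(6) by (simp add: hi_def)
    also have "\<dots> \<le> exp \<epsilon> * (2 * a * (1 - p) / b)"
      unfolding exp_eps using assms(5-7) by (intro mult_right_mono) auto
    finally show ?thesis
      using False by (simp add: lo_def)
  qed

  show "satisfies_LDP (kv_inputs d) (PCKV_UE d l a b p) \<epsilon>"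
    unfolding satisfies_LDP_def
  proof (intro ballI allI)
    fix S S' y
    assume S: "S \<in> kv_inputs d" "S' \<in> kv_inputs d"
    have "pmf (PCKV_UE d l a b p S) y \<le> hi * pmf Q y"
      using ratio[OF S(1)] by blast
    also have "\<dots> \<le> exp \<epsilon> * (lo * pmf Q y)"
      using mult_right_mono[OF hi_le, of "pmf Q y"] by (simp add: mult.assoc)
    also have "\<dots> \<le> exp \<epsilon> * pmf (PCKV_UE d l a b p S') y"
      using ratio[OF S(2)] by (intro mult_left_mono) auto
    finally show "pmf (PCKV_UE d l a b p S) y \<le> exp \<epsilon> * pmf (PCKV_UE d l a b p S') y" .
  qed

  show "\<epsilon> \<le> \<epsilon>\<^sub>1 + \<epsilon>\<^sub>2"
  proof -
    have one: "1 \<le> exp \<epsilon>\<^sub>1" "1 \<le> exp \<epsilon>\<^sub>2"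
      using assms(3,4) by simp_all
    \<comment> \<open>This is \<open>1 \<le> exp \<epsilon>\<^sub>2\<close> in disguise; it bounds
      the factor \<open>2 * p\<close> by \<open>exp \<epsilon>\<^sub>2\<close>.\<close>
    have "2 * exp \<epsilon>\<^sub>2 \<le> exp \<epsilon>\<^sub>2 * (exp \<epsilon>\<^sub>2 + 1)"
      using one by (subst mult.commute, intro mult_left_mono) auto
    then have "2 * (exp \<epsilon>\<^sub>2 / (exp \<epsilon>\<^sub>2 + 1)) \<le> exp \<epsilon>\<^sub>2"
      by (simp add: pos_divide_le_eq add_pos_pos)
    then have "exp \<epsilon> \<le> exp \<epsilon>\<^sub>1 * exp \<epsilon>\<^sub>2"
      unfolding assms(10) exp_privacy_level
      using one by (intro max.boundedI mult_left_mono) auto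
    then show ?thesis
      by (simp flip: exp_add)
  qed
qed

end
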